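(* For every integer $n\ge1$, $$f_2(3,n)\leq\begin{cases} n+2 & \text{if } n\equiv 1 \pmod 3,\\ n+3 & \text{otherwise,}\end{cases}$$ and equality holds at least for all $n\leq 10$.
   Context: Graphs are finite and simple with nonempty vertex set. A clique of a graph is a set of pairwise adjacent vertices (sets with at most one vertex are cliques); a clique is maximal if it is maximal with respect to inclusion, and $c(G)$ is the number of maximal cliques of $G$. For integers $t\geq2$ and $n\geq1$, $f_2(t,n)$ is the minimum of $\sum_{i=1}^t c(G_i)$ over all factorizations of the complete graph $K_n$ into $t$ edge-disjoint spanning subgraphs $G_1,\dots,G_t$ (all on the same $n$ vertices, some possibly edgeless, whose edge sets partition the edge set of $K_n$). *)

theory Defs
  imports Main "HOL-Library.Disjoint_Sets"
begin

text \<open>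
  A finite simple graph is given by its vertex set \<open>V\<close> and its edge set \<open>E\<close>, a set of
  two-element subsets of \<open>V\<close>.
\<close>

definition complete_edges :: "'a set \<Rightarrow> 'a set set" where
  "complete_edges V = {e. e \<subseteq> V \<and> card e = 2}"

definition clique :: "'a set \<Rightarrow> 'a set set \<Rightarrow> 'a set \<Rightarrow> bool" where
  "clique V E S \<longleftrightarrow> S \<subseteq> V \<and> (\<forall>u\<in>S. \<forall>v\<in>S. u \<noteq> v \<longrightarrow> {u, v} \<in> E)"

definition maximal_clique :: "'a set \<Rightarrow> 'a set set \<Rightarrow> 'a set \<Rightarrow> bool" where
  "maximal_clique V E S \<longleftrightarrow> clique V E S \<and> (\<forall>T. clique V E T \<and> S \<subseteq> T \<longrightarrow> T = S)"

definition num_maximal_cliques :: "'a set \<Rightarrow> 'a set set \<Rightarrow> nat" where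
  "num_maximal_cliques V E = card {S. maximal_clique V E S}"

text \<open>
  All factors have the full vertex set \<open>{..<n}\<close>, so a factor is determined by its edge set
  \<open>G i\<close>, which may be empty. Only the values \<open>G i\<close> with \<open>i < t\<close> matter.
\<close>

definition factorization :: "nat \<Rightarrow> nat \<Rightarrow> (nat \<Rightarrow> nat set set) \<Rightarrow> bool" where
  "factorization t n G \<longleftrightarrow>
     disjoint_family_on G {..<t} \<and> (\<Union>i<t. G i) = complete_edges {..<n}"

definition f2 :: "nat \<Rightarrow> nat \<Rightarrow> nat" where
  "f2 t n = (LEAST m. \<exists>G. factorization t n G \<and>
                          m = (\<Sum>i<t. num_maximal_cliques {..<n} (G i)))"

text \<open>
  For \<open>t \<ge> 1\<close> a factorization exists, so the minimum is attained and a lower bound for all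
  attained values.
\<close>

lemma factorization_exists:
  assumes "t \<ge> 1"
  shows "\<exists>G. factorization t n G"
proof
  show "factorization t n (\<lambda>i. if i = 0 then complete_edges {..<n} else {})"
    using assms by (auto simp: factorization_def disjoint_family_on_def split: if_splits)
qed

lemma f2_attained:
  assumes "t \<ge> 1"
  shows "\<exists>G. factorization t n G \<and> f2 t n = (\<Sum>i<t. num_maximal_cliques {..<n} (G i))"
  unfolding f2_def by (rule LeastI_ex) (use factorization_exists[OF assms, of n] in blast)

lemma f2_le:
  assumes "factorization t n G"
  shows "f2 t n \<le> (\<Sum>i<t. num_maximal_cliques {..<n} (G i))"
  unfolding f2_def by (rule Least_le) (use assms in blast)

end

theory Submission
  imports Defs
begin

text \<open>
  For the upper bound, the edges of \<open>K\<^sub>n\<close> are coloured along blocks of three consecutive vertices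
  (\<open>colour\<close>). In each colour the earlier neighbours of a vertex form a clique, so a maximal clique is
  determined by its largest vertex, and this vertex has no later neighbour in the colour
  (\<open>num_maximal_cliques_le\<close>). Prepending a block of three vertices adds one such vertex to each
  colour, so the total grows by three from \<open>n\<close> to \<open>n + 3\<close> (\<open>last_vertices_step\<close>), starting from the
  totals 3, 5 and 6 for \<open>n = 1, 2, 3\<close>.

  For the lower bound, only the set systems \<open>A\<close>, \<open>B\<close>, \<open>C\<close> of the maximal cliques of the three
  factors matter. Each covers the vertices, members of different systems share at most one vertex,
  and together they cover all pairs. Let \<open>\<alpha>\<close>, \<open>\<beta>\<close>, \<open>\<gamma>\<close> be their cardinalities and \<open>a\<close>, \<open>b\<close>, \<open>c\<close> the
  sums of the sizes of their members. The cliques of \<open>B\<close> through the vertices of a clique \<open>X \<in> A\<close>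
  are distinct, hence \<open>|X| \<le> \<beta>\<close> (\<open>card_member_le\<close>), and double counting gives \<open>a + b \<le> \<alpha> \<beta> + n\<close>
  (\<open>sum_cards_le\<close>); the same holds for the other pairs of systems. As a set of size \<open>k \<le> m\<close> has at
  most \<open>m (k - 1) / 2\<close> pairs, covering all pairs requires, for \<open>\<alpha> \<le> \<beta> \<le> \<gamma>\<close>,
  \<open>n (n - 1) \<le> \<beta> (a - \<alpha>) + \<alpha> (b - \<beta>) + \<alpha> (c - \<gamma>)\<close>.
  For \<open>n \<le> 10\<close> these linear inequalities exclude every \<open>\<alpha> + \<beta> + \<gamma>\<close> below the claimed value
  (\<open>sizes_arith\<close>), except for \<open>n = 9\<close> with \<open>(\<alpha>, \<beta>, \<gamma>) = (3, 4, 4)\<close> and \<open>(a, b, c) = (9, 12, 12)\<close>,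
  where all inequalities are nearly tight and the structure is rigid enough for a direct
  contradiction (\<open>not_tight_9\<close>).
\<close>

section \<open>A colouring with few maximal cliques\<close>

text \<open>
  The vertices are grouped into consecutive blocks of three. A vertex uses the colour given by its
  position in its block for all edges to later blocks; an edge inside a block gets the colour of
  the remaining third vertex. For \<open>n = 4\<close> this is the colouring of \<open>K\<^sub>4\<close> by three perfect
  matchings.
\<close>

definition colour :: "nat \<Rightarrow> nat \<Rightarrow> nat" where
  "colour u v = (if u div 3 = v div 3 then 3 - (u mod 3 + v mod 3) else u mod 3)"

definition colour_class :: "nat \<Rightarrow> nat \<Rightarrow> nat set set" where
  "colour_class n i = {{u, v} |u v. u < v \<and> v < n \<and> colour u v = i}"

lemma mod_3_less: "u < v \<Longrightarrow> u div 3 = v div 3 \<Longrightarrow> u mod 3 < v mod (3::nat)"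
  using div_mult_mod_eq[of u 3] div_mult_mod_eq[of v 3] by linarith

lemma colour_less_3: "u < v \<Longrightarrow> colour u v < 3"
  using mod_3_less[of u v] by (auto simp: colour_def)

lemma doubleton_in_colour_class:
  "u < v \<Longrightarrow> {u, v} \<in> colour_class n i \<longleftrightarrow> v < n \<and> colour u v = i"
  by (auto simp: colour_class_def doubleton_eq_iff)

lemma factorization_colour_class: "factorization 3 n (colour_class n)"
proof -
  have "complete_edges {..<n} \<subseteq> (\<Union>i<3. colour_class n i)"
  proof
    fix e assume "e \<in> complete_edges {..<n}"
    then have e: "e \<subseteq> {..<n}" "card e = 2" by (auto simp: complete_edges_def)
    then obtain u v where "e = {u, v}" "u < v"
      by (metis card_2_iff insert_commute nat_neq_iff)
    then show "e \<in> (\<Union>i<3. colour_class n i)"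
      using e colour_less_3 by (auto simp: doubleton_in_colour_class)
  qed
  moreover have "(\<Union>i<3. colour_class n i) \<subseteq> complete_edges {..<n}"
    by (auto simp: colour_class_def complete_edges_def)
  moreover have "disjoint_family_on (colour_class n) {..<3}"
    by (auto simp: disjoint_family_on_def colour_class_def doubleton_eq_iff)
  ultimately show ?thesis by (auto simp: factorization_def)
qed

definition last_vertices :: "nat \<Rightarrow> nat \<Rightarrow> nat set" where
  "last_vertices n i = {m. m < n \<and> (\<forall>v. m < v \<and> v < n \<longrightarrow> colour m v \<noteq> i)}"

text \<open>
  The earlier neighbours of \<open>m\<close> in a colour form a clique, so every colour class is a chordal graph:
  such neighbours are either all the vertices of the right position in earlier blocks, or these
  together with a single vertex of the same block.
\<close>

lemma colour_earlier_neighbours: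
  assumes "u < v" "v < m" "colour u m = i" "colour v m = i"
  shows "colour u v = i"
proof (cases "u div 3 = m div 3")
  case True
  moreover have "u div 3 \<le> v div 3" "v div 3 \<le> m div 3"
    using assms(1,2) by (simp_all add: div_le_mono)
  ultimately have same: "u div 3 = v div 3" "v div 3 = m div 3" by linarith+
  have "m mod 3 < 3" by simp
  with mod_3_less[OF assms(1) same(1)] mod_3_less[OF assms(2) same(2)]
  have "u mod 3 = 0" "v mod 3 = 1" "m mod 3 = 2" by linarith+
  then have "colour u m \<noteq> colour v m" using same by (simp add: colour_def)
  then show ?thesis using assms(3,4) by simp
next
  case False
  then have i: "u mod 3 = i" using assms(3) by (simp add: colour_def)
  show ?thesis
  proof (cases "u div 3 = v div 3")
    case True
    then have "v mod 3 = i" using assms(4) False by (simp add: colour_def)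
    then show ?thesis using mod_3_less[OF assms(1) True] i by simp
  next
    case False
    then show ?thesis using i by (simp add: colour_def)
  qed
qed

text \<open>
  Together with the previous lemma: if \<open>m\<close> has a later neighbour \<open>v\<close>, then \<open>m\<close> and all its
  earlier neighbours can be extended by \<open>v\<close>, so \<open>m\<close> is not the largest vertex of a maximal
  clique.
\<close>

lemma colour_trans:
  assumes "u < m" "m < v" "colour u m = i" "colour m v = i"
  shows "colour u v = i"
proof (cases "u div 3 = m div 3")
  case same: True
  then have less: "u mod 3 < m mod 3" using mod_3_less assms(1) by blast
  have "m mod 3 < 3" "v mod 3 < 3" by simp_all
  have um: "colour u m = 3 - (u mod 3 + m mod 3)" using same by (simp add: colour_def)
  have "colour u m \<noteq> colour m v"
  proof (cases "m div 3 = v div 3")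
    case True
    then have "m mod 3 < v mod 3" using mod_3_less assms(2) by blast
    with less \<open>v mod 3 < 3\<close> have "u mod 3 = 0" "m mod 3 = 1" "v mod 3 = 2" by linarith+
    then show ?thesis using um True by (simp add: colour_def)
  next
    case False
    then have "colour m v = m mod 3" by (simp add: colour_def)
    moreover have "3 - (p + q) \<noteq> q" if "p < q" "q < 3" for p q :: nat
      using that by presburger
    ultimately show ?thesis using um less \<open>m mod 3 < 3\<close> by metis
  qed
  then show ?thesis using assms(3,4) by simp
next
  case False
  moreover have "u div 3 \<le> m div 3" "m div 3 \<le> v div 3"
    using assms(1,2) by (simp_all add: div_le_mono)
  ultimately have "u div 3 \<noteq> v div 3" by linarith
  then show ?thesis using assms(3) False by (simp add: colour_def)
qed

text \<open>
  In a chordal graph with this vertex order, a maximal clique is determined by its largest vertex: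
  it consists of that vertex and all its earlier neighbours. By transitivity, only vertices without
  a later neighbour occur as largest vertices.
\<close>

lemma num_maximal_cliques_le:
  assumes "1 \<le> n"
  shows "num_maximal_cliques {..<n} (colour_class n i) \<le> card (last_vertices n i)"
proof -
  let ?cl = "clique {..<n} (colour_class n i)" and ?mc = "maximal_clique {..<n} (colour_class n i)"
  have cl: "?cl S \<longleftrightarrow> S \<subseteq> {..<n} \<and> (\<forall>u\<in>S. \<forall>v\<in>S. u < v \<longrightarrow> colour u v = i)" for S
  proof
    assume "?cl S"
    then show "S \<subseteq> {..<n} \<and> (\<forall>u\<in>S. \<forall>v\<in>S. u < v \<longrightarrow> colour u v = i)"
      unfolding clique_def using doubleton_in_colour_class by (metis less_irrefl)
  next
    assume S: "S \<subseteq> {..<n} \<and> (\<forall>u\<in>S. \<forall>v\<in>S. u < v \<longrightarrow> colour u v = i)"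
    have "{u, v} \<in> colour_class n i" if "u \<in> S" "v \<in> S" "u \<noteq> v" for u v
    proof (cases "u < v")
      case True
      then show ?thesis using S that by (auto simp: doubleton_in_colour_class)
    next
      case False
      then have "v < u" using that by simp
      then have "{v, u} \<in> colour_class n i" using S that by (auto simp: doubleton_in_colour_class)
      then show ?thesis by (simp add: insert_commute)
    qed
    then show "?cl S" using S by (simp add: clique_def)
  qed
  define N where "N m = insert m {u. u < m \<and> colour u m = i}" for m
  have N_clique: "?cl (N m)" if "m < n" for m
    using that colour_earlier_neighbours by (auto simp: cl N_def)
  have "S \<in> N ` last_vertices n i" if "?mc S" for S
  proof -
    have S: "?cl S" and max: "\<And>T. ?cl T \<Longrightarrow> S \<subseteq> T \<Longrightarrow> T = S"
      using that by (auto simp: maximal_clique_def)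
    have "?cl {0}" using assms by (auto simp: cl)
    then have "S \<noteq> {}" using max[of "{0}"] by auto
    moreover have "finite S" using S finite_subset by (auto simp: cl)
    ultimately have m: "Max S \<in> S" "\<And>u. u \<in> S \<Longrightarrow> u \<le> Max S" by auto
    then have "Max S < n" using S by (auto simp: cl)
    have "S \<subseteq> N (Max S)"
    proof
      fix u assume "u \<in> S"
      then have "u = Max S \<or> u < Max S" using m(2)[OF \<open>u \<in> S\<close>] by linarith
      then show "u \<in> N (Max S)" using S \<open>u \<in> S\<close> m(1) by (auto simp: N_def cl)
    qed
    with max N_clique[OF \<open>Max S < n\<close>] have eq: "S = N (Max S)" by blast
    have "colour (Max S) v \<noteq> i" if v: "Max S < v" "v < n" for v
    proof
      assume c: "colour (Max S) v = i"
      have "N (Max S) \<subseteq> N v" using v c colour_trans[of _ "Max S" v i] by (auto simp: N_def)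
      then have "N v = S" using max N_clique[OF v(2)] eq by blast
      then have "v \<in> S" by (auto simp: N_def)
      then show False using m(2) v(1) by fastforce
    qed
    then show ?thesis using eq \<open>Max S < n\<close> by (auto simp: last_vertices_def)
  qed
  then have "{S. ?mc S} \<subseteq> N ` last_vertices n i" by auto
  moreover have fin: "finite (last_vertices n i)" by (simp add: last_vertices_def)
  ultimately show ?thesis unfolding num_maximal_cliques_def
    by (meson card_image_le card_mono finite_imageI le_trans)
qed

lemma colour_shift: "colour (u + 3) (v + 3) = colour u v"
proof -
  have "(w + 3) div 3 = w div 3 + 1" "(w + 3) mod 3 = w mod 3" for w :: nat by simp_all
  then show ?thesis by (simp only: colour_def add_right_cancel)
qed

text \<open>
  The colouring of \<open>n + 3\<close> vertices is the one of \<open>n\<close> vertices, shifted by a block, behind a new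
  first block. In that block, the vertex at position \<open>i\<close> has later neighbours of colour \<open>i\<close> because
  \<open>n \<ge> 1\<close>, and the other two vertices are joined by an edge of colour \<open>i\<close>, so only the larger of
  them lacks a later neighbour.
\<close>

lemma last_vertices_step:
  assumes "1 \<le> n" "i < 3"
  shows "card (last_vertices (n + 3) i) \<le> card (last_vertices n i) + 1"
proof -
  \<comment> \<open>Vertex 0 has later neighbours in all colours, vertex 1 in the colours 0 and 1, and vertex 2
    in colour 2.\<close>
  have low: "m = (if i = 2 then 1 else 2)" if "m \<in> last_vertices (n + 3) i" "m < 3" for m
  proof -
    have *: "\<And>v. m < v \<Longrightarrow> v < n + 3 \<Longrightarrow> colour m v \<noteq> i"
      using that by (auto simp: last_vertices_def)
    consider "m = 0" | "m = 1" | "m = 2" using \<open>m < 3\<close> by linarith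
    then show ?thesis
    proof cases
      case 1
      then have "i \<noteq> 2" "i \<noteq> 1" "i \<noteq> 0"
        using *[of 1] *[of 2] *[of 3] assms(1) by (simp_all add: colour_def)
      then show ?thesis using assms(2) by linarith
    next
      case 2
      then have "i \<noteq> 0" "i \<noteq> 1"
        using *[of 2] *[of 3] assms(1) by (simp_all add: colour_def)
      then show ?thesis using 2 assms(2) by simp
    next
      case 3
      then have "i \<noteq> 2" using *[of 3] assms(1) by (simp add: colour_def)
      then show ?thesis using 3 by simp
    qed
  qed
  have "last_vertices (n + 3) i
      \<subseteq> insert (if i = 2 then 1 else 2) ((\<lambda>m. m + 3) ` last_vertices n i)"
  proof
    fix m assume m: "m \<in> last_vertices (n + 3) i"
    show "m \<in> insert (if i = 2 then 1 else 2) ((\<lambda>m. m + 3) ` last_vertices n i)"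
    proof (cases "m < 3")
      case True
      then show ?thesis using low[OF m] by simp
    next
      case False
      then have "m = (m - 3) + 3" by simp
      then obtain k where k: "m = k + 3" ..
      have "colour k v \<noteq> i" if "k < v" "v < n" for v
        using m that k by (auto simp: last_vertices_def simp flip: colour_shift[of k v])
      then have "k \<in> last_vertices n i" using m k by (auto simp: last_vertices_def)
      then show ?thesis using k by auto
    qed
  qed
  moreover have "finite (last_vertices n i)" by (simp add: last_vertices_def)
  ultimately have "card (last_vertices (n + 3) i)
      \<le> card (insert (if i = 2 then 1 else 2) ((\<lambda>m. m + 3) ` last_vertices n i))"
    by (intro card_mono) auto
  also have "\<dots> \<le> card ((\<lambda>m. m + 3) ` last_vertices n i) + 1"
    by (simp add: card_insert_le_m1 \<open>finite (last_vertices n i)\<close> card_insert_if)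
  also have "\<dots> = card (last_vertices n i) + 1" by (simp add: card_image)
  finally show ?thesis .
qed

lemma sum_last_vertices:
  assumes "1 \<le> n"
  shows "(\<Sum>i<3. card (last_vertices n i)) \<le> (if n mod 3 = 1 then n + 2 else n + 3)"
  using assms
proof (induction n rule: less_induct)
  case (less n)
  have three: "{..<3::nat} = {0, 1, 2}" by auto
  show ?case
  proof (cases "n \<le> 3")
    case True
    have colours: "colour 0 1 = 2" "colour 0 2 = 1" "colour 1 2 = 0"
      by (simp_all add: colour_def)
    have not_last: "m \<notin> last_vertices n (colour m v)" if "m < v" "v < n" for m v
      using that by (auto simp: last_vertices_def)
    have bound: "card (last_vertices n i) \<le> card ({..<n} - {m})"
      if "m \<notin> last_vertices n i" for m i
      using that by (intro card_mono) (auto simp: last_vertices_def)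
    have "card (last_vertices n i) \<le> n" for i
      using card_mono[of "{..<n}" "last_vertices n i"] by (auto simp: last_vertices_def)
    note le_n = this[of 0] this[of 1] this[of 2]
    have three_sum: "(\<Sum>i<3. card (last_vertices n i))
        = card (last_vertices n 0) + card (last_vertices n 1) + card (last_vertices n 2)"
      by (simp add: three)
    consider "n = 1" | "n = 2" | "n = 3" using True less.prems by linarith
    then show ?thesis
    proof cases
      case 1
      have "(\<Sum>i<3. card (last_vertices n i)) \<le> 3" unfolding three_sum using le_n 1 by linarith
      then show ?thesis by (simp only: 1) simp
    next
      case 2
      have "card (last_vertices n 2) \<le> 1"
        using bound[of 0 2] not_last[of 0 1] colours 2 by simp
      then have "(\<Sum>i<3. card (last_vertices n i)) \<le> 5" unfolding three_sum using le_n 2 by linarith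
      then show ?thesis by (simp only: 2) simp
    next
      case 3
      have "card (last_vertices n 2) \<le> 2"
        using bound[of 0 2] not_last[of 0 1] colours 3 by simp
      moreover have "card (last_vertices n 1) \<le> 2"
        using bound[of 0 1] not_last[of 0 2] colours 3 by simp
      moreover have "card (last_vertices n 0) \<le> 2"
        using bound[of 1 0] not_last[of 1 2] colours 3 by simp
      ultimately have "(\<Sum>i<3. card (last_vertices n i)) \<le> 6" unfolding three_sum by linarith
      then show ?thesis by (simp only: 3) simp
    qed
  next
    case False
    define k where "k = n - 3"
    then have k: "n = k + 3" "1 \<le> k" using False by simp_all
    have "(\<Sum>i<3. card (last_vertices n i)) \<le> (\<Sum>i<3. card (last_vertices k i) + 1)"
      using k by (intro sum_mono) (simp add: last_vertices_step[simplified])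
    also have "\<dots> = (\<Sum>i<3. card (last_vertices k i)) + 3" by (simp add: sum.distrib three)
    also have "\<dots> \<le> (if k mod 3 = 1 then k + 2 else k + 3) + 3"
      using less.IH[of k] k by simp
    also have "\<dots> = (if n mod 3 = 1 then n + 2 else n + 3)" using k(1) by simp
    finally show ?thesis .
  qed
qed

lemma f2_3_upper_bound:
  assumes "1 \<le> n"
  shows "f2 3 n \<le> (if n mod 3 = 1 then n + 2 else n + 3)"
proof -
  have "f2 3 n \<le> (\<Sum>i<3. num_maximal_cliques {..<n} (colour_class n i))"
    by (rule f2_le[OF factorization_colour_class])
  also have "\<dots> \<le> (\<Sum>i<3. card (last_vertices n i))"
    by (intro sum_mono num_maximal_cliques_le assms)
  also note sum_last_vertices[OF assms]
  finally show ?thesis .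
qed

section \<open>Double counting for a pair of covers\<close>

definition multiplicity :: "'a set set \<Rightarrow> 'a \<Rightarrow> nat" where
  "multiplicity P v = card {X \<in> P. v \<in> X}"

lemma sum_members_eq_sum_multiplicity:
  fixes w :: "'a \<Rightarrow> nat"
  assumes "finite V" "finite P" "\<Union>P \<subseteq> V"
  shows "(\<Sum>X\<in>P. \<Sum>v\<in>X. w v) = (\<Sum>v\<in>V. multiplicity P v * w v)"
proof -
  have "(\<Sum>X\<in>P. \<Sum>v\<in>X. w v) = (\<Sum>X\<in>P. \<Sum>v\<in>{v\<in>V. v \<in> X}. w v)"
    using assms(3) by (intro sum.cong refl) auto
  also have "\<dots> = (\<Sum>v\<in>V. \<Sum>X\<in>{X\<in>P. v \<in> X}. w v)"
    using assms by (intro sum.swap_restrict) auto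
  finally show ?thesis by (simp add: multiplicity_def)
qed

lemma sum_multiplicity_over:
  assumes "finite X" "finite Q"
  shows "(\<Sum>v\<in>X. multiplicity Q v) = (\<Sum>Y\<in>Q. card (X \<inter> Y))"
proof -
  have "(\<Sum>v\<in>X. \<Sum>Y\<in>{Y\<in>Q. v \<in> Y}. 1) = (\<Sum>Y\<in>Q. \<Sum>v\<in>{v\<in>X. v \<in> Y}. 1::nat)"
    using assms by (intro sum.swap_restrict) auto
  then show ?thesis by (simp add: multiplicity_def Int_def)
qed

text \<open>
  Maximal cliques of two edge-disjoint graphs on the same vertices share at most one vertex. This
  property and the fact that either family covers the vertices give all inequalities between two
  factors that the lower bound uses.
\<close>

locale orthogonal_covers =
  fixes V :: "'a set" and P Q :: "'a set set"
  assumes finite_V: "finite V"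
    and covers_P: "\<Union>P = V" and covers_Q: "\<Union>Q = V"
    and meet: "X \<in> P \<Longrightarrow> Y \<in> Q \<Longrightarrow> card (X \<inter> Y) \<le> 1"
begin

lemma finite_P: "finite P" and finite_Q: "finite Q"
  using finite_V covers_P covers_Q by (metis finite_UnionD)+

lemma sym: "orthogonal_covers V Q P"
proof
  show "card (X \<inter> Y) \<le> 1" if "X \<in> Q" "Y \<in> P" for X Y
    using meet[OF that(2,1)] by (simp add: Int_commute)
qed (fact finite_V covers_P covers_Q)+

lemma multiplicity_pos:
  assumes "v \<in> V"
  shows "1 \<le> multiplicity P v" "1 \<le> multiplicity Q v"
  using assms finite_P finite_Q covers_P covers_Q
  by (auto simp: multiplicity_def Suc_le_eq card_gt_0_iff)

text \<open>
  The members of \<open>Q\<close> containing a given vertex of \<open>X\<close> contain no other vertex of \<open>X\<close>, so the members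
  of \<open>Q\<close> are counted at most once on the left.
\<close>

lemma sum_multiplicity_member:
  assumes "X \<in> P"
  shows "(\<Sum>v\<in>X. multiplicity Q v) \<le> card Q"
proof -
  have "finite X" using assms covers_P finite_V by (metis Union_upper finite_subset)
  then have "(\<Sum>v\<in>X. multiplicity Q v) = (\<Sum>Y\<in>Q. card (X \<inter> Y))"
    by (rule sum_multiplicity_over) (rule finite_Q)
  also have "\<dots> \<le> (\<Sum>Y\<in>Q. 1)" using meet[OF assms] by (rule sum_mono)
  finally show ?thesis by simp
qed

lemma card_member_le:
  assumes "X \<in> P"
  shows "card X \<le> card Q"
proof -
  have "card X = (\<Sum>v\<in>X. 1)" by simp
  also have "\<dots> \<le> (\<Sum>v\<in>X. multiplicity Q v)"
    using assms covers_P by (intro sum_mono multiplicity_pos) auto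
  finally show ?thesis using sum_multiplicity_member[OF assms] by simp
qed

lemma sum_card_eq: "(\<Sum>X\<in>P. card X) = (\<Sum>v\<in>V. multiplicity P v)"
  using sum_members_eq_sum_multiplicity[OF finite_V finite_P, of "\<lambda>_. 1"] covers_P by simp

lemma card_le_sum_card: "card V \<le> (\<Sum>X\<in>P. card X)"
proof -
  have "card V = (\<Sum>v\<in>V. 1)" by simp
  also have "\<dots> \<le> (\<Sum>v\<in>V. multiplicity P v)" by (intro sum_mono multiplicity_pos)
  finally show ?thesis by (simp add: sum_card_eq)
qed

lemma sum_multiplicity_product:
  "(\<Sum>v\<in>V. multiplicity P v * multiplicity Q v) \<le> card P * card Q"
proof -
  have "(\<Sum>v\<in>V. multiplicity P v * multiplicity Q v) = (\<Sum>X\<in>P. \<Sum>v\<in>X. multiplicity Q v)"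
    using sum_members_eq_sum_multiplicity[OF finite_V finite_P] covers_P by simp
  also have "\<dots> \<le> (\<Sum>X\<in>P. card Q)" by (intro sum_mono sum_multiplicity_member)
  finally show ?thesis by simp
qed

text \<open>
  Summing \<open>(p - 1) (q - 1) \<ge> 0\<close> over the multiplicities \<open>p\<close> and \<open>q\<close> of a vertex in the two covers
  turns the bound on the sum of the products \<open>p q\<close> into a linear one on the total sizes.
\<close>

lemma sum_cards_le:
  "(\<Sum>X\<in>P. card X) + (\<Sum>Y\<in>Q. card Y) \<le> card P * card Q + card V"
proof -
  have *: "p + q \<le> p * q + 1" if "1 \<le> p" "1 \<le> q" for p q :: nat
    using that by (auto simp: dest!: le_Suc_ex)
  have "(\<Sum>X\<in>P. card X) + (\<Sum>Y\<in>Q. card Y) = (\<Sum>v\<in>V. multiplicity P v + multiplicity Q v)"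
    by (simp add: sum_card_eq orthogonal_covers.sum_card_eq[OF sym] sum.distrib)
  also have "\<dots> \<le> (\<Sum>v\<in>V. multiplicity P v * multiplicity Q v + 1)"
    by (intro sum_mono * multiplicity_pos)
  also have "\<dots> = (\<Sum>v\<in>V. multiplicity P v * multiplicity Q v) + card V"
    by (simp only: sum.distrib) simp
  finally show ?thesis using sum_multiplicity_product by linarith
qed

text \<open>
  Under the first assumption every member of \<open>P\<close> attains the bound of
  \<open>sum_multiplicity_member\<close>; for a singleton this says that its vertex lies in every member of \<open>Q\<close>.
\<close>

lemma in_all_if_singleton:
  assumes "card P * card Q \<le> (\<Sum>Y\<in>Q. card Y)" and "{z} \<in> P" and "Y \<in> Q"
  shows "z \<in> Y"
proof -
  have "(\<Sum>X\<in>P. card Q) \<le> (\<Sum>v\<in>V. multiplicity Q v)"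
    using assms(1) by (simp add: orthogonal_covers.sum_card_eq[OF sym])
  also have "\<dots> \<le> (\<Sum>v\<in>V. multiplicity P v * multiplicity Q v)"
    using multiplicity_pos by (intro sum_mono) (auto dest!: le_Suc_ex)
  also have "\<dots> = (\<Sum>X\<in>P. \<Sum>v\<in>X. multiplicity Q v)"
    using sum_members_eq_sum_multiplicity[OF finite_V finite_P] covers_P by simp
  finally have le: "(\<Sum>X\<in>P. card Q) \<le> (\<Sum>X\<in>P. \<Sum>v\<in>X. multiplicity Q v)" .
  have "card Q \<le> (\<Sum>v\<in>{z}. multiplicity Q v)"
  proof (rule ccontr)
    assume "\<not> ?thesis"
    then have "(\<Sum>X\<in>P. \<Sum>v\<in>X. multiplicity Q v) < (\<Sum>X\<in>P. card Q)"
      using assms(2) by (intro sum_strict_mono_ex1 finite_P ballI sum_multiplicity_member bexI[of _ "{z}"]) auto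
    with le show False by simp
  qed
  then have "{X \<in> Q. z \<in> X} = Q"
    using finite_Q by (intro card_seteq) (auto simp: multiplicity_def)
  then show ?thesis using assms(3) by auto
qed

end

section \<open>Three pairwise orthogonal covers\<close>

text \<open>
  The families of maximal cliques of the three factors. Since every edge lies in a maximal clique of
  its factor, the cliques cover all pairs of vertices; \<open>pairs\<close> is the counted form of this.
\<close>

locale clique_covers =
  AB: orthogonal_covers V A B + AC: orthogonal_covers V A C + BC: orthogonal_covers V B C
  for V :: "'a set" and A B C +
  assumes V_nonempty: "V \<noteq> {}"
    and nonempty: "{} \<notin> A" "{} \<notin> B" "{} \<notin> C"
    and pairs: "card V choose 2 \<le> (\<Sum>X\<in>A. card X choose 2) + (\<Sum>Y\<in>B. card Y choose 2)
      + (\<Sum>Z\<in>C. card Z choose 2)"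
begin

lemma finite_member: "X \<in> A \<or> X \<in> B \<or> X \<in> C \<Longrightarrow> finite X"
  using AB.finite_V AB.covers_P AB.covers_Q AC.covers_Q by (metis Union_upper finite_subset)

lemma swap_AB: "clique_covers V B A C"
  by (intro clique_covers.intro clique_covers_axioms.intro AB.sym BC.orthogonal_covers_axioms
      AC.orthogonal_covers_axioms V_nonempty nonempty) (use pairs in simp)

lemma swap_BC: "clique_covers V A C B"
  by (intro clique_covers.intro clique_covers_axioms.intro AB.orthogonal_covers_axioms BC.sym
      AC.orthogonal_covers_axioms V_nonempty nonempty) (use pairs in simp)

end

text \<open>
  A set with \<open>k \<in> {1..m}\<close> elements has \<open>k (k - 1) / 2 \<le> m (k - 1) / 2\<close> pairs. Being linear in
  \<open>k\<close>, this limits the pairs covered by a family through its cardinality and total size alone.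
\<close>

lemma sum_choose_two_le:
  assumes "{} \<notin> P" and "\<And>X. X \<in> P \<Longrightarrow> finite X \<and> card X \<le> m"
  shows "2 * (\<Sum>X\<in>P. card X choose 2) + m * card P \<le> m * (\<Sum>X\<in>P. card X)"
proof -
  have "2 * (card X choose 2) + m \<le> m * card X" if "X \<in> P" for X
  proof -
    have "card X \<noteq> 0" using assms that by (metis card_0_eq)
    then obtain k where k: "card X = Suc k" using not0_implies_Suc by blast
    have "2 * (card X choose 2) = card X * k"
      using dvd_mult_div_cancel[of 2 "card X * (card X - 1)"] by (simp add: choose_two k)
    also have "\<dots> \<le> m * k" using assms(2)[OF that] by (intro mult_right_mono) auto
    finally show ?thesis by (simp add: k)
  qed
  then have "(\<Sum>X\<in>P. 2 * (card X choose 2) + m) \<le> (\<Sum>X\<in>P. m * card X)" by (rule sum_mono)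
  then show ?thesis by (simp add: sum.distrib sum_distrib_left mult.commute)
qed

text \<open>
  Here \<open>\<alpha>\<close>, \<open>\<beta>\<close>, \<open>\<gamma>\<close> are the numbers of cliques of the three factors, and \<open>a\<close>, \<open>b\<close>, \<open>c\<close> the total
  sizes of these cliques. Cliques of the first factor have at most \<open>\<beta>\<close> vertices, those of the other
  factors at most \<open>\<alpha>\<close>, which gives \<open>edges\<close>. One case with too few cliques survives the counting.
\<close>

lemma sizes_arith:
  fixes \<alpha> \<beta> \<gamma> a b c n :: nat
  assumes "1 \<le> \<alpha>" "\<alpha> \<le> \<beta>" "\<beta> \<le> \<gamma>" "1 \<le> n" "n \<le> 10"
    and small: "\<alpha> + \<beta> + \<gamma> < (if n mod 3 = 1 then n + 2 else n + 3)"
    and ab: "a + b \<le> \<alpha> * \<beta> + n" and ac: "a + c \<le> \<alpha> * \<gamma> + n" and bc: "b + c \<le> \<beta> * \<gamma> + n"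
    and n: "n \<le> a" "n \<le> b" "n \<le> c"
    and edges: "n * (n - 1) + \<beta> * \<alpha> + \<alpha> * \<beta> + \<alpha> * \<gamma> \<le> \<beta> * a + \<alpha> * b + \<alpha> * c"
  shows "n = 9 \<and> \<alpha> = 3 \<and> \<beta> = 4 \<and> \<gamma> = 4 \<and> a = 9 \<and> b = 12 \<and> c = 12"
proof -
  have n_le: "n \<le> \<alpha> * \<beta>" "n \<le> \<alpha> * \<gamma>" using ab ac n by linarith+
  have sum_less: "\<alpha> + \<beta> + \<gamma> < n + 3" using small by (simp split: if_splits)
  have "\<alpha> \<le> 3"
  proof (rule ccontr)
    assume big: "\<not> \<alpha> \<le> 3"
    then have "n = 10" using sum_less assms(2,3,5) by linarith
    then show False using small big assms(2,3) by simp
  qed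
  then consider "\<alpha> = 1" | "\<alpha> = 2" | "\<alpha> = 3" using assms(1) by linarith
  then show ?thesis
  proof cases
    case 1
    then have "n = 1" using n_le sum_less assms(4) by simp
    then show ?thesis using 1 small n_le assms(2,3) by simp
  next
    case 2
    then have "n = 2 * \<beta>" "\<gamma> = \<beta>" using n_le sum_less by auto
    moreover have "\<beta> \<in> {2, 3, 4, 5}" using 2 assms(2,5) \<open>n = 2 * \<beta>\<close> by auto
    ultimately show ?thesis using 2 ab ac bc n edges small by auto
  next
    case 3
    have pq: "n * (n - 1) + 6 * \<beta> + 3 * \<gamma> \<le> \<beta> * a + 3 * b + 3 * c"
      "a + b \<le> 3 * \<beta> + n" "a + c \<le> 3 * \<gamma> + n" "n \<le> 3 * \<beta>"
      using edges ab ac n_le 3 by (simp_all add: mult.commute)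
    have "\<beta> = 3 \<or> \<beta> = 4" using sum_less assms(2,3,5) 3 by linarith
    then show ?thesis
    proof
      assume \<beta>: "\<beta> = 3"
      then have "n = 8 \<and> (\<gamma> = 3 \<or> \<gamma> = 4) \<or> n = 9 \<and> (\<gamma> = 3 \<or> \<gamma> = 4 \<or> \<gamma> = 5)"
        using sum_less assms(3) 3 pq(4) small by presburger
      moreover have "b + c \<le> 3 * \<gamma> + n" using bc \<beta> by simp
      ultimately have False using pq(1-3) \<beta> by auto
      then show ?thesis ..
    next
      assume \<beta>: "\<beta> = 4"
      then have n9_10: "n = 9 \<or> n = 10" using sum_less assms(3,5) 3 by linarith
      then have \<gamma>: "\<gamma> = 4" using small assms(3) 3 \<beta> by auto
      from n9_10 show ?thesis
      proof
        assume n9: "n = 9"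
        have "72 + 36 \<le> 4 * a + 3 * b + 3 * c" "a + b \<le> 21" "a + c \<le> 21" "b + c \<le> 25"
          using pq bc unfolding \<beta> \<gamma> n9 by simp_all
        moreover have "9 \<le> a" using n n9 by simp
        ultimately have "a = 9" "b = 12" "c = 12" by linarith+
        then show ?thesis using n9 3 \<beta> \<gamma> by simp
      next
        assume n10: "n = 10"
        have "90 + 36 \<le> 4 * a + 3 * b + 3 * c" "a + b \<le> 22" "a + c \<le> 22"
          using pq unfolding \<beta> \<gamma> n10 by simp_all
        moreover have "10 \<le> a" using n n10 by simp
        ultimately have False by linarith
        then show ?thesis ..
      qed
    qed
  qed
qed

context clique_covers
begin

text \<open>
  In the surviving case the three cliques of the first factor must partition the vertices into parts
  of sizes 4, 4 and 1, since no other sizes provide enough edges. The vertex of the singleton part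
  then lies in all cliques of both other factors, so that any edge at it belongs to both factors.
\<close>

lemma not_tight_9:
  assumes "card V = 9" "card A = 3" "card B = 4" "card C = 4"
    and a: "(\<Sum>X\<in>A. card X) = 9" and b: "(\<Sum>Y\<in>B. card Y) = 12" and c: "(\<Sum>Z\<in>C. card Z) = 12"
  shows False
proof -
  note fin = finite_member
  have small: "1 \<le> card X \<and> card X \<le> 4" if "X \<in> A" for X
    using AB.card_member_le[OF that] fin that nonempty assms by (auto simp: Suc_le_eq card_gt_0_iff)
  have B3: "card Y \<le> 3" if "Y \<in> B" for Y
    using orthogonal_covers.card_member_le[OF AB.sym that] assms by simp
  have C3: "card Z \<le> 3" if "Z \<in> C" for Z
    using orthogonal_covers.card_member_le[OF AC.sym that] assms by simp
  have "2 * (\<Sum>Y\<in>B. card Y choose 2) \<le> 24"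
    using sum_choose_two_le[OF nonempty(2), of 3] fin B3 b assms by auto
  moreover have "2 * (\<Sum>Z\<in>C. card Z choose 2) \<le> 24"
    using sum_choose_two_le[OF nonempty(3), of 3] fin C3 c assms by auto
  moreover have "card V choose 2 = 36" using assms by (simp add: choose_two)
  ultimately have edges_A: "12 \<le> (\<Sum>X\<in>A. card X choose 2)" using pairs by linarith
  have "\<exists>X\<in>A. card X = 1"
  proof (rule ccontr)
    assume "\<not> ?thesis"
    then have none: "\<forall>X\<in>A. card X \<noteq> 1" by blast
    \<comment> \<open>The chord of \<open>k (k - 1)\<close> between \<open>k = 2\<close> and \<open>k = 4\<close>.\<close>
    have "2 * (card X choose 2) + 8 \<le> 5 * card X" if "X \<in> A" for X
    proof -
      have "card X = 2 \<or> card X = 3 \<or> card X = 4"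
        using small[OF that] none that by force
      then show ?thesis by (auto simp: choose_two)
    qed
    then have "(\<Sum>X\<in>A. 2 * (card X choose 2) + 8) \<le> (\<Sum>X\<in>A. 5 * card X)" by (rule sum_mono)
    then have "2 * (\<Sum>X\<in>A. card X choose 2) + 24 \<le> 5 * 9"
      using assms by (simp add: sum.distrib flip: sum_distrib_left)
    with edges_A show False by linarith
  qed
  then obtain z where z: "{z} \<in> A" by (metis card_1_singletonE)
  obtain u where u: "u \<in> V" "u \<noteq> z"
  proof -
    have "\<not> V \<subseteq> {z}" using assms card_mono[of "{z}" V] by auto
    then show ?thesis using that by blast
  qed
  obtain Y Z where YZ: "Y \<in> B" "u \<in> Y" "Z \<in> C" "u \<in> Z"
    using u BC.covers_P BC.covers_Q by blast
  have "z \<in> Y" using AB.in_all_if_singleton[OF _ z] YZ b assms by simp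
  moreover have "z \<in> Z" using AC.in_all_if_singleton[OF _ z] YZ c assms by simp
  ultimately have "{u, z} \<subseteq> Y \<inter> Z" using YZ by auto
  then have "card {u, z} \<le> card (Y \<inter> Z)" using fin YZ by (intro card_mono) auto
  then show False using BC.meet[OF YZ(1,3)] u by simp
qed

lemma lower_bound_sorted:
  assumes "card V \<le> 10" "card A \<le> card B" "card B \<le> card C"
  shows "(if card V mod 3 = 1 then card V + 2 else card V + 3) \<le> card A + card B + card C"
proof (rule ccontr)
  assume neg: "\<not> ?thesis"
  note fin = finite_member
  let ?n = "card V" and ?a = "\<Sum>X\<in>A. card X" and ?b = "\<Sum>Y\<in>B. card Y" and ?c = "\<Sum>Z\<in>C. card Z"
  have n1: "1 \<le> ?n" using V_nonempty AB.finite_V by (simp add: Suc_le_eq card_gt_0_iff)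
  have "A \<noteq> {}" using V_nonempty AB.covers_P by auto
  then have A1: "1 \<le> card A" using AB.finite_P by (simp add: Suc_le_eq card_gt_0_iff)
  have eA: "2 * (\<Sum>X\<in>A. card X choose 2) + card B * card A \<le> card B * ?a"
    using fin by (intro sum_choose_two_le nonempty conjI AB.card_member_le) auto
  have eB: "2 * (\<Sum>Y\<in>B. card Y choose 2) + card A * card B \<le> card A * ?b"
    using fin orthogonal_covers.card_member_le[OF AB.sym]
    by (intro sum_choose_two_le nonempty conjI) auto
  have eC: "2 * (\<Sum>Z\<in>C. card Z choose 2) + card A * card C \<le> card A * ?c"
    using fin orthogonal_covers.card_member_le[OF AC.sym]
    by (intro sum_choose_two_le nonempty conjI) auto
  have "even (?n * (?n - 1))" by auto
  then have "?n * (?n - 1) = 2 * (?n choose 2)" by (simp only: choose_two dvd_mult_div_cancel)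
  with eA eB eC pairs have "?n * (?n - 1) + card B * card A + card A * card B + card A * card C
      \<le> card B * ?a + card A * ?b + card A * ?c" by linarith
  note edges = this
  have "card A + card B + card C < (if ?n mod 3 = 1 then ?n + 2 else ?n + 3)"
    using neg by (simp only: not_le)
  from sizes_arith[OF A1 assms(2,3) n1 assms(1) this AB.sum_cards_le AC.sum_cards_le
      BC.sum_cards_le AB.card_le_sum_card BC.card_le_sum_card
      orthogonal_covers.card_le_sum_card[OF AC.sym] edges]
  show False by (elim conjE) (rule not_tight_9)
qed

lemma lower_bound:
  assumes "card V \<le> 10"
  shows "(if card V mod 3 = 1 then card V + 2 else card V + 3) \<le> card A + card B + card C"
proof -
  have BAC: "clique_covers V B A C" by (rule swap_AB)
  have ACB: "clique_covers V A C B" by (rule swap_BC)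
  have BCA: "clique_covers V B C A" by (rule clique_covers.swap_BC[OF BAC])
  have CAB: "clique_covers V C A B" by (rule clique_covers.swap_AB[OF ACB])
  have CBA: "clique_covers V C B A" by (rule clique_covers.swap_BC[OF CAB])
  note sorted = lower_bound_sorted clique_covers.lower_bound_sorted[OF BAC]
    clique_covers.lower_bound_sorted[OF ACB] clique_covers.lower_bound_sorted[OF BCA]
    clique_covers.lower_bound_sorted[OF CAB] clique_covers.lower_bound_sorted[OF CBA]
  show ?thesis using sorted[OF assms] by linarith
qed

end

section \<open>The maximal cliques of a factorization\<close>

lemma finite_maximal_cliques: "finite V \<Longrightarrow> finite {S. maximal_clique V E S}"
  by (rule finite_subset[of _ "Pow V"]) (auto simp: maximal_clique_def clique_def)

lemma clique_extends:
  assumes "finite V" "clique V E S"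
  shows "\<exists>T. maximal_clique V E T \<and> S \<subseteq> T"
proof -
  have "finite {T. clique V E T}"
    by (rule finite_subset[of _ "Pow V"]) (auto simp: clique_def assms(1))
  moreover have "S \<in> {T. clique V E T}" using assms(2) by simp
  ultimately obtain T where T: "T \<in> {T. clique V E T}" "S \<subseteq> T"
    "\<forall>U\<in>{T. clique V E T}. T \<subseteq> U \<longrightarrow> T = U"
    using finite_has_maximal2 by metis
  then have "maximal_clique V E T" by (simp add: maximal_clique_def) metis
  with T(2) show ?thesis by blast
qed

lemma Union_maximal_cliques:
  assumes "finite V"
  shows "\<Union>{S. maximal_clique V E S} = V"
proof
  show "\<Union>{S. maximal_clique V E S} \<subseteq> V" by (auto simp: maximal_clique_def clique_def)
  show "V \<subseteq> \<Union>{S. maximal_clique V E S}"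
  proof
    fix v assume "v \<in> V"
    then have "clique V E {v}" by (auto simp: clique_def)
    from clique_extends[OF assms this] show "v \<in> \<Union>{S. maximal_clique V E S}" by auto
  qed
qed

lemma card_pairs:
  assumes "finite X"
  shows "card (complete_edges X) = card X choose 2"
  unfolding complete_edges_def using n_subsets[OF assms] by simp

lemma card_edges_le:
  assumes "finite V" "E \<subseteq> complete_edges V"
  shows "card E \<le> (\<Sum>X | maximal_clique V E X. card X choose 2)"
proof -
  have fin: "finite X" if "maximal_clique V E X" for X
    using that assms(1) finite_subset by (auto simp: maximal_clique_def clique_def)
  have "E \<subseteq> (\<Union>X\<in>{X. maximal_clique V E X}. complete_edges X)"
  proof
    fix e assume "e \<in> E"
    then obtain u v where e: "e = {u, v}" "u \<noteq> v" "e \<subseteq> V" and "card e = 2"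
      using assms(2) by (auto simp: complete_edges_def card_2_iff)
    have "clique V E e" using e \<open>e \<in> E\<close> by (auto simp: clique_def insert_commute)
    from clique_extends[OF assms(1) this] \<open>card e = 2\<close>
    show "e \<in> (\<Union>X\<in>{X. maximal_clique V E X}. complete_edges X)"
      by (auto simp: complete_edges_def)
  qed
  then have "card E \<le> card (\<Union>X\<in>{X. maximal_clique V E X}. complete_edges X)"
    using fin assms(1) by (intro card_mono finite_UN_I finite_maximal_cliques)
      (auto simp: complete_edges_def)
  also have "\<dots> \<le> (\<Sum>X | maximal_clique V E X. card (complete_edges X))"
    using assms(1) by (intro card_UN_le finite_maximal_cliques)
  also have "\<dots> = (\<Sum>X | maximal_clique V E X. card X choose 2)"
    using fin by (intro sum.cong) (auto simp: card_pairs)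
  finally show ?thesis .
qed

lemma orthogonal_maximal_cliques:
  assumes "finite V" "E \<inter> F = {}"
  shows "orthogonal_covers V {S. maximal_clique V E S} {S. maximal_clique V F S}"
proof
  fix X Y assume *: "X \<in> {S. maximal_clique V E S}" "Y \<in> {S. maximal_clique V F S}"
  show "card (X \<inter> Y) \<le> 1"
  proof (rule ccontr)
    assume "\<not> ?thesis"
    then have "\<not> is_singleton (X \<inter> Y)" "X \<inter> Y \<noteq> {}" by (auto simp: is_singleton_altdef)
    then obtain u v where "u \<in> X \<inter> Y" "v \<in> X \<inter> Y" "u \<noteq> v"
      by (metis all_not_in_conv is_singletonI')
    then have "{u, v} \<in> E \<inter> F" using * by (auto simp: maximal_clique_def clique_def)
    with assms(2) show False by auto
  qed
qed (simp_all add: assms Union_maximal_cliques)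

lemma sum_cliques_lower_bound:
  assumes "factorization 3 n G" "1 \<le> n" "n \<le> 10"
  shows "(if n mod 3 = 1 then n + 2 else n + 3) \<le> (\<Sum>i<3. num_maximal_cliques {..<n} (G i))"
proof -
  let ?M = "\<lambda>i. {S. maximal_clique {..<n} (G i) S}"
  have disj: "G i \<inter> G j = {}" if "i < 3" "j < 3" "i \<noteq> j" for i j
    using assms(1) that by (auto simp: factorization_def disjoint_family_on_def)
  have edges: "(\<Union>i<3. G i) = complete_edges {..<n}"
    using assms(1) by (simp add: factorization_def)
  have three: "{..<3::nat} = {0, 1, 2}" by auto
  have sub: "G i \<subseteq> complete_edges {..<n}" if "i < 3" for i using edges that by auto
  have ne: "{} \<notin> ?M i" for i
  proof -
    have "clique {..<n} (G i) {0}" using assms(2) by (auto simp: clique_def)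
    then show ?thesis unfolding maximal_clique_def by blast
  qed
  have "n choose 2 = card (\<Union>i<3. G i)" using edges by (simp add: card_pairs)
  also have "\<dots> \<le> (\<Sum>i<3. card (G i))" by (rule card_UN_le) simp
  also have "\<dots> \<le> (\<Sum>i<3. \<Sum>X\<in>?M i. card X choose 2)"
    using sub by (intro sum_mono card_edges_le) auto
  finally have pairs: "n choose 2 \<le> (\<Sum>i<3. \<Sum>X\<in>?M i. card X choose 2)" .
  interpret clique_covers "{..<n}" "?M 0" "?M 1" "?M 2"
    by (intro clique_covers.intro clique_covers_axioms.intro orthogonal_maximal_cliques disj ne)
      (use assms(2) pairs in \<open>simp_all add: three lessThan_empty_iff\<close>)
  have "(if n mod 3 = 1 then n + 2 else n + 3) \<le> card (?M 0) + card (?M 1) + card (?M 2)"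
    using lower_bound assms(3) by (simp only: card_lessThan)
  also have "\<dots> = (\<Sum>i<3. num_maximal_cliques {..<n} (G i))"
    by (simp add: three num_maximal_cliques_def)
  finally show ?thesis .
qed

theorem theorem23:
  fixes n :: nat
  assumes "n \<ge> 1"
  shows "f2 3 n \<le> (if n mod 3 = 1 then n + 2 else n + 3) \<and>
         (n \<le> 10 \<longrightarrow> f2 3 n = (if n mod 3 = 1 then n + 2 else n + 3))"
proof (intro conjI impI)
  show upper: "f2 3 n \<le> (if n mod 3 = 1 then n + 2 else n + 3)"
    by (rule f2_3_upper_bound[OF assms])
  assume "n \<le> 10"
  obtain G where G: "factorization 3 n G"
    and eq: "f2 3 n = (\<Sum>i<3. num_maximal_cliques {..<n} (G i))"
    using f2_attained[of 3 n] by auto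
  have "(if n mod 3 = 1 then n + 2 else n + 3) \<le> f2 3 n"
    unfolding eq by (rule sum_cliques_lower_bound[OF G assms \<open>n \<le> 10\<close>])
  with upper show "f2 3 n = (if n mod 3 = 1 then n + 2 else n + 3)" by (rule antisym)
qed

end
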